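(* Assume the standing assumptions (A1)–(A6) of the context. Let $\alpha:(0,+\infty)\to(0,+\infty)$ satisfy $\lim_{\delta\to0}\alpha(\delta)=0$ and $\lim_{\delta\to0}\delta^2/\alpha(\delta)=0$. Let $\{\delta_k\}\subset(0,\infty)$ and $\{y^{\delta_k}\}\subset Y$ be sequences with $\lim_{k\to\infty}\delta_k=0$ and $\|y^{\delta_k}-y\|_2\le\delta_k$. Set $\alpha_k:=\alpha(\delta_k)$, $\Theta_k:=\Theta(\delta_k,y^{\delta_k})$ and $\Psi^{\delta_k}_{\Theta_k}:=\Psi_{\Theta_k}(y^{\delta_k})$. Let $\{x_k\}\subset X$ be any sequence such that, for every $k$, $$x_k\in\operatorname{argmin}_{x\in X}\Big\{\tfrac12\|Kx-y^{\delta_k}\|_2^2+\alpha_k\|\Delta_{\Psi^{\delta_k}_{\Theta_k}}x\|_1\Big\}.$$ Then $\{x_k\}$ has a convergent subsequence. The limit $x_{\mathrm{sol}}$ of the convergent subsequence $\{x_{k'}\}$ is a graph-minimizing solution with respect to $x_0$, and $$\lim_{k'}\|\Delta_{\Psi^{\delta_{k'}}_{\Theta_{k'}}}x_{k'}\|_1=\|\Delta_{x_0}x_{\mathrm{sol}}\|_1 .$$ If the graph-minimizing solution $x_{\mathrm{sol}}$ with respect to $x_0$ is unique, then $x_k\to x_{\mathrm{sol}}$.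
   Context: Setting: $X=\mathbb{R}^n$, $Y=\mathbb{R}^m$, $K:X\to Y$ is linear, $y\in Y$ is the exact datum. $P$ is a finite set with $n$ elements, and $X$ is identified with the space $C(P)$ of real functions on $P$; $x(p)$ is the value of $x$ at $p\in P$. Graph Laplacian induced by $x\in X$: fix a distance $\operatorname{dist}$ on $P$, a function $h_{\mathrm d}:\mathbb{R}\to[0,\infty)$ with $h_{\mathrm d}(0)=0$, and a function $h_{\mathrm i}:\mathbb{R}\to[0,\infty)$. Put $w_{\mathrm d}(p,q)=h_{\mathrm d}(\operatorname{dist}(p,q))$ and, for $x\in X$, $w_x(p,q)=w_{\mathrm d}(p,q)\,h_{\mathrm i}(|x(p)-x(q)|)$ (edge weights). Fix also, for each $x\in X$, a strictly positive function $\mu_x:P\to(0,\infty)$ (node measure). The graph Laplacian induced by $x$ is the linear map $\Delta_x:X\to X$, $\Delta_x u(p)=\frac1{\mu_x(p)}\sum_{q\in P}w_x(p,q)(u(p)-u(q))$. Reconstructors: $\{\Psi_\Theta:Y\to X\}$ is a family of (not necessarily linear) maps with parameters $\Theta$ in a subset of some $\mathbb{R}^\ell$; $\Theta=\Theta(\delta,y^\delta)$ is a parameter choice rule, defined for $\delta>0$, $y^\delta\in Y$. Write $\Psi^\delta_\Theta:=\Psi_{\Theta(\delta,y^\delta)}(y^\delta)\in X$. Standing assumptions: (A1) There is $x_{\mathrm{gt}}\in X$ with $Kx_{\mathrm{gt}}=y$. (A2) There is $x_0\in X$ such that $\|\Psi_{\Theta(\delta,y^\delta)}(y^\delta)-x_0\|_2\to0$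 as $\delta\to0$, for noisy data $y^\delta$ with $\|y^\delta-y\|_2\le\delta$ (i.e. along every sequence $\delta_k\to0$, $\|y^{\delta_k}-y\|_2\le\delta_k$). (A3) For fixed $\delta$, $y^\delta$, $\Theta=\Theta(\delta,y^\delta)$, and sequences $\delta_k\to\delta$, $y^{\delta_k}\to y^\delta$, writing $\Theta_k=\Theta(\delta_k,y^{\delta_k})$, one has $\Theta_k\to\Theta$ and $\|\Psi_{\Theta_k}(y^{\delta_k})-\Psi_\Theta(y^\delta)\|_2\to0$. (A4) For every $\delta$, $y^\delta$ and all $p,q\in P$: $w_{\Psi^\delta_\Theta}(p,q)>0$ if and only if $w_{x_0}(p,q)>0$. Consequently all $\Delta_{\Psi^\delta_\Theta}$ and $\Delta_{x_0}$ have the same kernel, denoted $V$. (A5) $\ker(K)\cap V=\{0\}$. (A6) $h_{\mathrm i}$ is Lipschitz and, for every fixed $p\in P$, the map $x\mapsto\mu_x(p)$ is Lipschitz. Graph-minimizing solution with respect to $x_0$: an element $x_{\mathrm{sol}}\in X$ with $Kx_{\mathrm{sol}}=y$ and $\|\Delta_{x_0}x_{\mathrm{sol}}\|_1=\min\{\|\Delta_{x_0}x\|_1: x\in X,\ Kx=y\}$. *)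

theory Defs
  imports "HOL-Analysis.Analysis"
begin

text \<open>A function on the finite node type \<open>'p\<close> is a vector of \<open>real ^ 'p\<close>. The distance
  \<open>d\<close> on the nodes is an explicit argument: \<open>'p\<close> is not required to be an instance of
  \<open>metric_space\<close>.\<close>

definition edge_weight ::
  "('p \<Rightarrow> 'p \<Rightarrow> real) \<Rightarrow> (real \<Rightarrow> real) \<Rightarrow> (real \<Rightarrow> real) \<Rightarrow> real ^ 'p \<Rightarrow> 'p \<Rightarrow> 'p \<Rightarrow> real" where
  "edge_weight d h_d h_i x p q = h_d (d p q) * h_i \<bar>x $ p - x $ q\<bar>"

definition graph_laplacian ::
  "('p \<Rightarrow> 'p \<Rightarrow> real) \<Rightarrow> (real \<Rightarrow> real) \<Rightarrow> (real \<Rightarrow> real) \<Rightarrow> (real ^ 'p \<Rightarrow> 'p \<Rightarrow> real)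
    \<Rightarrow> real ^ 'p \<Rightarrow> real ^ 'p \<Rightarrow> real ^ 'p" where
  "graph_laplacian d h_d h_i \<mu> x u =
     (\<chi> p. 1 / \<mu> x p * (\<Sum>q\<in>UNIV. edge_weight d h_d h_i x p q * (u $ p - u $ q)))"

definition norm1 :: "real ^ 'p \<Rightarrow> real" where
  "norm1 x = (\<Sum>p\<in>UNIV. \<bar>x $ p\<bar>)"

text \<open>The argument \<open>\<Delta>\<close> is a family of maps; \<open>\<Delta> x\<close> is the graph Laplacian induced by \<open>x\<close>.\<close>

definition graph_minimizing_solution ::
  "(real ^ 'p \<Rightarrow> real ^ 'm) \<Rightarrow> real ^ 'm \<Rightarrow> (real ^ 'p \<Rightarrow> real ^ 'p \<Rightarrow> real ^ 'p)
    \<Rightarrow> real ^ 'p \<Rightarrow> real ^ 'p \<Rightarrow> bool" where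
  "graph_minimizing_solution K y \<Delta> x0 xsol \<longleftrightarrow>
     is_arg_min (\<lambda>x. norm1 (\<Delta> x0 x)) (\<lambda>x. K x = y) xsol"

end

(* The argmin property, tested against an exact solution x*, gives
   |D_k x_k| <= \<delta>_k^2 / (2 \<alpha>_k) + |D_k x*| and K x_k \<longlongrightarrow> y, where D_k is the Laplacian of the
   k-th reconstruction. Since D_k u_k \<longlongrightarrow> D u whenever u_k \<longlongrightarrow> u, with D the Laplacian of x_0, a limit
   of normalised x_k along an unbounded subsequence would be a unit vector in ker K \<inter> ker D = {0}.
   So (x_k) is bounded, and everything else is a passage to the limit in the inequality. *)

theory Submission
  imports Defs
begin

lemma norm1_nonneg: "0 \<le> norm1 x"
  unfolding norm1_def by (simp add: sum_nonneg)

lemma norm_le_norm1: "norm (x :: real ^ 'p::finite) \<le> norm1 x"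
  unfolding norm1_def by (rule norm_le_l1_cart)

lemma tendsto_norm1:
  assumes "(f \<longlongrightarrow> l) F"
  shows "((\<lambda>k. norm1 (f k :: real ^ 'p::finite)) \<longlongrightarrow> norm1 l) F"
  unfolding norm1_def by (intro tendsto_intros assms)

lemma graph_laplacian_scaleR:
  "graph_laplacian d h_d h_i \<mu> x (c *\<^sub>R u) = c *\<^sub>R graph_laplacian d h_d h_i \<mu> x u"
  unfolding graph_laplacian_def by (simp add: vec_eq_iff sum_distrib_left algebra_simps)

text \<open>Joint continuity: the inducing vector and the argument move at the same time. The
  weights follow \<open>z\<close> through \<open>h_i\<close>, the factors from \<open>h_d\<close>
  are constants, and a nonzero \<open>\<mu> x p\<close> keeps the reciprocal continuous at the
  limit; the sum over nodes is finite.\<close>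

lemma tendsto_graph_laplacian:
  fixes x :: "real ^ 'p::finite"
  assumes "continuous_on UNIV h_i"
    and "\<And>p. continuous_on UNIV (\<lambda>x. \<mu> x p)"
    and "\<And>p. \<mu> x p \<noteq> 0"
    and z: "(z \<longlongrightarrow> x) F" and u: "(u \<longlongrightarrow> v) F"
  shows "((\<lambda>k. graph_laplacian d h_d h_i \<mu> (z k) (u k)) \<longlongrightarrow> graph_laplacian d h_d h_i \<mu> x v) F"
proof (rule vec_tendstoI)
  fix p
  have h: "((\<lambda>k. h_i \<bar>z k $ p - z k $ q\<bar>) \<longlongrightarrow> h_i \<bar>x $ p - x $ q\<bar>) F" for q
    by (rule continuous_on_tendsto_compose[OF assms(1)]) (auto intro!: tendsto_intros z)
  have m: "((\<lambda>k. \<mu> (z k) p) \<longlongrightarrow> \<mu> x p) F"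
    by (rule continuous_on_tendsto_compose[OF assms(2) z]) auto
  show "((\<lambda>k. graph_laplacian d h_d h_i \<mu> (z k) (u k) $ p)
      \<longlongrightarrow> graph_laplacian d h_d h_i \<mu> x v $ p) F"
    unfolding graph_laplacian_def edge_weight_def vec_lambda_beta
    by (intro tendsto_intros h m u assms(3))
qed

text \<open>Compactness of the unit sphere: normalised terms of an unbounded subsequence cluster at
  a unit vector, which homogeneity and boundedness of \<open>f k (x k)\<close> force into the zero
  set of \<open>g\<close>. In \<open>cont\<close> only the operators are reindexed by
  \<open>r\<close>, since the normalised vectors are already numbered along the subsequence.\<close>

lemma Bseq_if_limit_operator_injective:
  fixes x :: "nat \<Rightarrow> 'a::euclidean_space" and f :: "nat \<Rightarrow> 'a \<Rightarrow> 'b::real_normed_vector"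
  assumes scale: "\<And>k c u. f k (c *\<^sub>R u) = c *\<^sub>R f k u"
    and cont: "\<And>r u v. \<lbrakk>strict_mono (r :: nat \<Rightarrow> nat); u \<longlonglongrightarrow> v\<rbrakk> \<Longrightarrow> (\<lambda>k. f (r k) (u k)) \<longlonglongrightarrow> g v"
    and inj: "\<And>v. g v = 0 \<Longrightarrow> v = 0"
    and bd: "Bseq (\<lambda>k. f k (x k))"
  shows "Bseq x"
proof (rule ccontr)
  assume unb: "\<not> Bseq x"
  \<comment> \<open>Large terms must occur beyond every index \<open>m\<close>, so that the choice
    below can be made strictly increasing. This holds because a bound on a tail already gives
    \<open>Bseq x\<close>.\<close>
  have "\<exists>k>m. norm (x k) > real n" for m n
  proof (rule ccontr)
    assume "\<not> (\<exists>k>m. norm (x k) > real n)"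
    then have "eventually (\<lambda>k. norm (x k) \<le> norm (real n)) sequentially"
      unfolding eventually_at_top_dense real_norm_def by (metis abs_of_nat not_less)
    then have "Bseq x" by (rule Bseq_eventually_mono) simp
    with unb show False by simp
  qed
  then obtain s where s: "strict_mono s" and big: "\<And>n. norm (x (s n)) > real n"
    using dependent_nat_choice[of "\<lambda>n k. norm (x k) > real n" "\<lambda>_ i j. i < j"]
    by (metis strict_mono_Suc_iff)
  define v where "v n = (1 / norm (x (s n))) *\<^sub>R x (s n)" for n
  have v1: "norm (v n) = 1" for n using big[of n] by (auto simp: v_def)
  have "bounded (range v)" by (auto simp: bounded_iff v1)
  then obtain l t where t: "strict_mono t" and lim: "(v \<circ> t) \<longlonglongrightarrow> l"
    using bounded_imp_convergent_subsequence[of v] by auto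
  have "(\<lambda>n. norm (v (t n))) \<longlonglongrightarrow> norm l"
    using tendsto_norm[OF lim] by (simp add: o_def)
  then have l1: "norm l = 1" by (simp add: v1 LIMSEQ_const_iff)
  have "filterlim (\<lambda>n. norm (x (s n))) at_top sequentially"
    by (rule filterlim_at_top_mono[OF filterlim_real_sequentially])
      (use big in \<open>auto intro: less_imp_le always_eventually\<close>)
  then have "(\<lambda>n. 1 / norm (x (s n))) \<longlonglongrightarrow> 0"
    by (rule tendsto_divide_0[OF tendsto_const filterlim_at_top_imp_at_infinity])
  moreover have "Bseq (\<lambda>n. f (s n) (x (s n)))"
    using Bseq_subseq[OF bd, of s] by (simp add: o_def)
  \<comment> \<open>A null scalar sequence times a bounded vector sequence; by \<open>scale\<close>
    this product is \<open>f (s n) (v n)\<close>.\<close>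
  ultimately have "(\<lambda>n. (1 / norm (x (s n))) *\<^sub>R f (s n) (x (s n))) \<longlonglongrightarrow> 0"
    unfolding tendsto_Zfun_iff diff_0_right Bfun_def
    by (intro bounded_bilinear.Zfun_prod_Bfun[OF bounded_bilinear_scaleR]) (auto simp: Bfun_def)
  then have "(\<lambda>n. f (s n) (v n)) \<longlonglongrightarrow> 0" by (simp add: v_def scale)
  then have "(\<lambda>n. f ((s \<circ> t) n) ((v \<circ> t) n)) \<longlonglongrightarrow> 0"
    using LIMSEQ_subseq_LIMSEQ[OF _ t] by (fastforce simp: o_def)
  moreover have "(\<lambda>n. f ((s \<circ> t) n) ((v \<circ> t) n)) \<longlonglongrightarrow> g l"
    by (rule cont[OF strict_mono_o[OF s t] lim])
  ultimately have "g l = 0" using LIMSEQ_unique by blast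
  then have "l = 0" by (rule inj)
  with l1 show False by simp
qed

text \<open>If \<open>x\<close> did not converge to \<open>l\<close>, some subsequence would stay at
  distance at least \<open>e\<close> from \<open>l\<close>. Being bounded, it has a convergent
  further subsequence, whose limit would have to be \<open>l\<close>.\<close>

lemma LIMSEQ_if_all_subseq_limits_eq:
  fixes x :: "nat \<Rightarrow> 'a::heine_borel"
  assumes bd: "bounded (range x)"
    and uniq: "\<And>r m. \<lbrakk>strict_mono (r :: nat \<Rightarrow> nat); (x \<circ> r) \<longlonglongrightarrow> m\<rbrakk> \<Longrightarrow> m = l"
  shows "x \<longlonglongrightarrow> l"
proof (rule ccontr)
  assume "\<not> x \<longlonglongrightarrow> l"
  then obtain e where e: "e > 0" "\<not> eventually (\<lambda>n. dist (x n) l < e) sequentially"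
    unfolding tendsto_iff by blast
  then obtain s :: "nat \<Rightarrow> nat" where s: "strict_mono s" "\<And>n. \<not> dist (x (s n)) l < e"
    using not_eventually_sequentiallyD[OF e(2)] by blast
  have "bounded (range (x \<circ> s))" by (rule bounded_subset[OF bd]) auto
  then obtain m t where t: "strict_mono t" and lim: "(x \<circ> s \<circ> t) \<longlonglongrightarrow> m"
    using bounded_imp_convergent_subsequence by blast
  have "m = l" using uniq[OF strict_mono_o[OF s(1) t]] lim by (simp add: o_assoc)
  then have "eventually (\<lambda>n. dist ((x \<circ> s \<circ> t) n) l < e) sequentially"
    using lim e(1) unfolding tendsto_iff by blast
  then show False using s(2) by (auto simp: eventually_sequentially)
qed

theorem theorem3p15:
  fixes K :: "real ^ 'p::finite \<Rightarrow> real ^ 'm::finite"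
    and y :: "real ^ 'm"
    and d :: "'p \<Rightarrow> 'p \<Rightarrow> real"
    and h_d h_i :: "real \<Rightarrow> real"
    and \<mu> :: "real ^ 'p \<Rightarrow> 'p \<Rightarrow> real"
    and T :: "(real ^ 'l::finite) set"
    and \<Psi> :: "real ^ 'l \<Rightarrow> real ^ 'm \<Rightarrow> real ^ 'p"
    and \<Theta> :: "real \<Rightarrow> real ^ 'm \<Rightarrow> real ^ 'l"
    and x_gt x0 :: "real ^ 'p"
    and \<alpha> :: "real \<Rightarrow> real"
    and \<delta>s :: "nat \<Rightarrow> real"
    and ys :: "nat \<Rightarrow> real ^ 'm"
    and xs :: "nat \<Rightarrow> real ^ 'p"
  assumes K_linear: "linear K"
    and dist: "Metric_space UNIV d"
    and hd_nonneg: "\<And>t. 0 \<le> h_d t" and hd_0: "h_d 0 = 0"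
    and hi_nonneg: "\<And>t. 0 \<le> h_i t"
    and mu_pos: "\<And>x p. 0 < \<mu> x p"
    and Theta_mem: "\<And>\<delta> z. 0 < \<delta> \<Longrightarrow> \<Theta> \<delta> z \<in> T"
    and A1: "K x_gt = y"
    and A2: "\<And>\<epsilon> z. \<lbrakk>\<And>k. 0 < \<epsilon> k; \<epsilon> \<longlonglongrightarrow> 0; \<And>k. norm (z k - y) \<le> \<epsilon> k\<rbrakk>
      \<Longrightarrow> (\<lambda>k. norm (\<Psi> (\<Theta> (\<epsilon> k) (z k)) (z k) - x0)) \<longlonglongrightarrow> 0"
    and A3: "\<And>\<delta> y\<^sub>\<delta> \<epsilon> z. \<lbrakk>0 < \<delta>; \<And>k. 0 < \<epsilon> k; \<epsilon> \<longlonglongrightarrow> \<delta>; z \<longlonglongrightarrow> y\<^sub>\<delta>\<rbrakk>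
      \<Longrightarrow> (\<lambda>k. \<Theta> (\<epsilon> k) (z k)) \<longlonglongrightarrow> \<Theta> \<delta> y\<^sub>\<delta> \<and>
          (\<lambda>k. norm (\<Psi> (\<Theta> (\<epsilon> k) (z k)) (z k) - \<Psi> (\<Theta> \<delta> y\<^sub>\<delta>) y\<^sub>\<delta>)) \<longlonglongrightarrow> 0"
    and A4: "\<And>\<delta> z p q. 0 < \<delta> \<Longrightarrow>
      edge_weight d h_d h_i (\<Psi> (\<Theta> \<delta> z) z) p q > 0 \<longleftrightarrow> edge_weight d h_d h_i x0 p q > 0"
    and A5: "{x. K x = 0} \<inter> {x. graph_laplacian d h_d h_i \<mu> x0 x = 0} = {0}"
    and A6_hi: "\<exists>L. L-lipschitz_on UNIV h_i"
    and A6_mu: "\<And>p. \<exists>L. L-lipschitz_on UNIV (\<lambda>x. \<mu> x p)"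
    and alpha_pos: "\<And>\<delta>. 0 < \<delta> \<Longrightarrow> 0 < \<alpha> \<delta>"
    and alpha_lim: "(\<alpha> \<longlongrightarrow> 0) (at_right 0)"
    and alpha_rate: "((\<lambda>\<delta>. \<delta>\<^sup>2 / \<alpha> \<delta>) \<longlongrightarrow> 0) (at_right 0)"
    and delta_pos: "\<And>k. 0 < \<delta>s k" and delta_lim: "\<delta>s \<longlonglongrightarrow> 0"
    and noise: "\<And>k. norm (ys k - y) \<le> \<delta>s k"
    and xs_argmin: "\<And>k. is_arg_min
      (\<lambda>x. 1 / 2 * (norm (K x - ys k))\<^sup>2
         + \<alpha> (\<delta>s k) * norm1 (graph_laplacian d h_d h_i \<mu> (\<Psi> (\<Theta> (\<delta>s k) (ys k)) (ys k)) x))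
      (\<lambda>x. x \<in> UNIV) (xs k)"
  shows
    "(\<exists>r xsol. strict_mono (r :: nat \<Rightarrow> nat) \<and> (xs \<circ> r) \<longlonglongrightarrow> xsol) \<and>
     (\<forall>r xsol. strict_mono (r :: nat \<Rightarrow> nat) \<and> (xs \<circ> r) \<longlonglongrightarrow> xsol \<longrightarrow>
        graph_minimizing_solution K y (graph_laplacian d h_d h_i \<mu>) x0 xsol \<and>
        (\<lambda>k. norm1 (graph_laplacian d h_d h_i \<mu>
               (\<Psi> (\<Theta> (\<delta>s (r k)) (ys (r k))) (ys (r k))) (xs (r k))))
          \<longlonglongrightarrow> norm1 (graph_laplacian d h_d h_i \<mu> x0 xsol)) \<and>
     (\<forall>xsol. graph_minimizing_solution K y (graph_laplacian d h_d h_i \<mu>) x0 xsol \<and>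
        (\<forall>x. graph_minimizing_solution K y (graph_laplacian d h_d h_i \<mu>) x0 x \<longrightarrow> x = xsol)
        \<longrightarrow> xs \<longlonglongrightarrow> xsol)"
proof -
  define z where "z k = \<Psi> (\<Theta> (\<delta>s k) (ys k)) (ys k)" for k
  define D where "D = graph_laplacian d h_d h_i \<mu>"
  \<comment> \<open>The noise term of the optimality inequality after division by \<alpha>; it is
    half of the ratio in \<open>alpha_rate\<close>, hence null.\<close>
  define \<rho> where "\<rho> k = (\<delta>s k)\<^sup>2 / (2 * \<alpha> (\<delta>s k))" for k
  have z_lim: "z \<longlonglongrightarrow> x0"
    using A2[OF delta_pos delta_lim noise] unfolding z_def
    by (simp add: tendsto_norm_zero_iff LIM_zero_iff)
  have hi_cont: "continuous_on UNIV h_i" and mu_cont: "\<And>p. continuous_on UNIV (\<lambda>x. \<mu> x p)"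
    using A6_hi A6_mu lipschitz_on_continuous_on by blast+
  \<comment> \<open>As in the boundedness lemma, \<open>r\<close> reindexes \<open>z\<close> but not
    \<open>u\<close>, which need not be a subsequence of anything. This one fact serves blow-up
    sequences, subsequences of \<open>xs\<close> and constant competitors.\<close>
  have D_lim: "(\<lambda>k. D (z (r k)) (u k)) \<longlonglongrightarrow> D x0 v" if "strict_mono r" "u \<longlonglongrightarrow> v" for r :: "nat \<Rightarrow> nat" and u v
    unfolding D_def
    using LIMSEQ_subseq_LIMSEQ[OF z_lim that(1)] mu_pos that(2)
    by (intro tendsto_graph_laplacian hi_cont mu_cont) (auto simp: o_def less_imp_neq[THEN not_sym])
  have delta_right: "filterlim \<delta>s (at_right 0) sequentially"
    using delta_lim delta_pos by (intro tendsto_imp_filterlim_at_right) auto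
  have al_lim: "(\<lambda>k. \<alpha> (\<delta>s k)) \<longlonglongrightarrow> 0"
    by (rule filterlim_compose[OF alpha_lim delta_right])
  have \<rho>_lim: "\<rho> \<longlonglongrightarrow> 0"
    using tendsto_mult_left[OF filterlim_compose[OF alpha_rate delta_right], of "1/2"]
    by (simp add: \<rho>_def[abs_def] field_simps)
  have al_pos: "0 < \<alpha> (\<delta>s k)" for k using alpha_pos delta_pos by blast
  \<comment> \<open>Minimality against an exact solution \<open>x\<close>, whose residual is pure
    noise and so at most \<open>\<delta>s k\<close>.\<close>
  have opt: "1/2 * (norm (K (xs k) - ys k))\<^sup>2 + \<alpha> (\<delta>s k) * norm1 (D (z k) (xs k))
      \<le> 1/2 * (\<delta>s k)\<^sup>2 + \<alpha> (\<delta>s k) * norm1 (D (z k) x)" if "K x = y" for x k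
  proof -
    have "1/2 * (norm (K (xs k) - ys k))\<^sup>2 + \<alpha> (\<delta>s k) * norm1 (D (z k) (xs k))
        \<le> 1/2 * (norm (K x - ys k))\<^sup>2 + \<alpha> (\<delta>s k) * norm1 (D (z k) x)"
      using xs_argmin[of k] by (auto simp: is_arg_min_def not_less D_def z_def)
    moreover have "(norm (K x - ys k))\<^sup>2 \<le> (\<delta>s k)\<^sup>2"
      using noise[of k] that by (intro power_mono) (auto simp: norm_minus_commute)
    ultimately show ?thesis by simp
  qed
  \<comment> \<open>Drop the residual of \<open>xs k\<close> from \<open>opt\<close> and divide by
    \<alpha>.\<close>
  have D_le: "norm1 (D (z k) (xs k)) \<le> \<rho> k + norm1 (D (z k) x)" if "K x = y" for x k
  proof -
    have "0 \<le> 1/2 * (norm (K (xs k) - ys k))\<^sup>2" by simp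
    then have "\<alpha> (\<delta>s k) * norm1 (D (z k) (xs k)) \<le> 1/2 * (\<delta>s k)\<^sup>2 + \<alpha> (\<delta>s k) * norm1 (D (z k) x)"
      using opt[OF that, of k] by linarith
    also have "\<dots> = \<alpha> (\<delta>s k) * (\<rho> k + norm1 (D (z k) x))"
      using al_pos[of k] by (simp add: \<rho>_def field_simps)
    finally show ?thesis using al_pos[of k] by simp
  qed
  have D_const: "(\<lambda>k. norm1 (D (z (r k)) x)) \<longlonglongrightarrow> norm1 (D x0 x)"
    if "strict_mono r" for r :: "nat \<Rightarrow> nat" and x
    by (rule tendsto_norm1[OF D_lim[OF that tendsto_const]])
  have K_lim: "(\<lambda>k. K (xs k)) \<longlonglongrightarrow> y"
  proof -
    \<comment> \<open>The opposite use of \<open>opt\<close>: drop the penalty of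
      \<open>xs k\<close> and double. Since the penalties of \<open>x_gt\<close> converge, \<alpha>
      tending to 0 makes this bound null.\<close>
    let ?b = "\<lambda>k. (\<delta>s k)\<^sup>2 + 2 * (\<alpha> (\<delta>s k) * norm1 (D (z k) x_gt))"
    have "?b \<longlonglongrightarrow> 0\<^sup>2 + 2 * (0 * norm1 (D x0 x_gt))"
      using D_const[OF strict_mono_id] by (intro tendsto_intros delta_lim al_lim) (simp add: id_def)
    then have b: "?b \<longlonglongrightarrow> 0" by simp
    have le: "(norm (K (xs k) - ys k))\<^sup>2 \<le> ?b k" for k
    proof -
      have "0 \<le> \<alpha> (\<delta>s k) * norm1 (D (z k) (xs k))"
        using al_pos[of k] by (simp add: norm1_nonneg)
      then show ?thesis using opt[OF A1, of k] by simp
    qed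
    have "(\<lambda>k. (norm (K (xs k) - ys k))\<^sup>2) \<longlonglongrightarrow> 0"
      by (rule tendsto_sandwich[OF _ _ tendsto_const b]) (simp_all add: le)
    from tendsto_real_sqrt[OF this] have "(\<lambda>k. K (xs k) - ys k) \<longlonglongrightarrow> 0"
      by (simp add: tendsto_norm_zero_iff)
    moreover have "(\<lambda>k. ys k - y) \<longlonglongrightarrow> 0"
      using noise by (intro Lim_null_comparison[OF _ delta_lim]) (auto intro: always_eventually)
    ultimately show ?thesis
      using tendsto_add[of "\<lambda>k. K (xs k) - ys k" 0 _ "\<lambda>k. ys k - y" 0] by (simp add: LIM_zero_iff)
  qed
  have K_cont: "(\<lambda>k. K (u k)) \<longlonglongrightarrow> K v" if "u \<longlonglongrightarrow> v" for u v
    using bounded_linear.tendsto[OF _ that] K_linear by (simp add: linear_conv_bounded_linear)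
  have "Bseq xs"
  \<comment> \<open>Pairing \<open>K\<close> with the Laplacian turns A5 into injectivity of a
    single limit operator. Its first component is bounded by \<open>K_lim\<close>, its second by
    \<open>D_le\<close> for \<open>x_gt\<close>.\<close>
  proof (rule Bseq_if_limit_operator_injective[where f = "\<lambda>k x. (K x, D (z k) x)" and g = "\<lambda>x. (K x, D x0 x)"])
    show "(K (c *\<^sub>R u), D (z k) (c *\<^sub>R u)) = c *\<^sub>R (K u, D (z k) u)" for k c u
      using K_linear by (simp add: D_def graph_laplacian_scaleR linear_scale)
    show "(\<lambda>k. (K (u k), D (z (r k)) (u k))) \<longlonglongrightarrow> (K v, D x0 v)"
      if "strict_mono r" "u \<longlonglongrightarrow> v" for r :: "nat \<Rightarrow> nat" and u v
      by (intro tendsto_Pair K_cont D_lim that)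
    show "v = 0" if "(K v, D x0 v) = 0" for v
      using that A5 by (auto simp: D_def zero_prod_def)
    have "(\<lambda>k. \<rho> k + norm1 (D (z k) x_gt)) \<longlonglongrightarrow> 0 + norm1 (D x0 x_gt)"
      using D_const[OF strict_mono_id] by (intro tendsto_intros \<rho>_lim) (simp add: id_def)
    then have "Bseq (\<lambda>k. \<rho> k + norm1 (D (z k) x_gt))"
      using convergent_imp_Bseq convergentI by blast
    then have "Bseq (\<lambda>k. D (z k) (xs k))"
    proof (rule Bseq_eventually_mono[rotated])
      show "eventually (\<lambda>k. norm (D (z k) (xs k)) \<le> norm (\<rho> k + norm1 (D (z k) x_gt))) sequentially"
        using order_trans[OF order_trans[OF norm_le_norm1 D_le[OF A1]] abs_ge_self]
        by (intro always_eventually) simp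
    qed
    moreover have "Bseq (\<lambda>k. K (xs k))"
      using K_lim convergent_imp_Bseq convergentI by blast
    ultimately obtain a b where "\<And>k. norm (K (xs k)) \<le> a" "\<And>k. norm (D (z k) (xs k)) \<le> b"
      unfolding Bseq_def by blast
    then show "Bseq (\<lambda>k. (K (xs k), D (z k) (xs k)))"
      by (intro BseqI'[of _ "a + b"]) (meson add_mono norm_Pair_le order_trans)
  qed
  then have bd: "bounded (range xs)" by (simp add: Bseq_eq_bounded)
  have main: "graph_minimizing_solution K y D x0 w \<and>
      (\<lambda>k. norm1 (D (z (r k)) (xs (r k)))) \<longlonglongrightarrow> norm1 (D x0 w)"
    if r: "strict_mono r" and lim: "(xs \<circ> r) \<longlonglongrightarrow> w" for r :: "nat \<Rightarrow> nat" and w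
  proof
    show N: "(\<lambda>k. norm1 (D (z (r k)) (xs (r k)))) \<longlonglongrightarrow> norm1 (D x0 w)"
      \<comment> \<open>Convergence of the penalties is continuity alone; minimality enters only in
        the comparison below.\<close>
      using tendsto_norm1[OF D_lim[OF r lim]] by simp
    have "(\<lambda>k. K (xs (r k))) \<longlonglongrightarrow> y" using LIMSEQ_subseq_LIMSEQ[OF K_lim r] by (simp add: o_def)
    moreover have "(\<lambda>k. K (xs (r k))) \<longlonglongrightarrow> K w" using K_cont[OF lim] by simp
    ultimately have "K w = y" using LIMSEQ_unique by blast
    moreover have "norm1 (D x0 w) \<le> norm1 (D x0 x)" if "K x = y" for x
    \<comment> \<open>Pass to the limit along \<open>r\<close> in \<open>D_le\<close> with the
      competitor \<open>x\<close> fixed: the left side tends to the penalty of \<open>w\<close>, and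
      \<rho> disappears on the right.\<close>
    proof (rule LIMSEQ_le[OF N])
      have "(\<lambda>k. \<rho> (r k)) \<longlonglongrightarrow> 0" using LIMSEQ_subseq_LIMSEQ[OF \<rho>_lim r] by (simp add: o_def)
      from tendsto_add[OF this D_const[OF r]]
      show "(\<lambda>k. \<rho> (r k) + norm1 (D (z (r k)) x)) \<longlonglongrightarrow> norm1 (D x0 x)" by simp
    qed (use D_le[OF that] in blast)
    ultimately show "graph_minimizing_solution K y D x0 w"
      by (auto simp: graph_minimizing_solution_def is_arg_min_def not_less)
  qed
  have ex: "\<exists>r w. strict_mono (r :: nat \<Rightarrow> nat) \<and> (xs \<circ> r) \<longlonglongrightarrow> w"
    using bounded_imp_convergent_subsequence[OF bd] by blast
  \<comment> \<open>By \<open>main\<close> every subsequential limit is graph-minimizing, so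
    uniqueness makes all of them equal to \<open>w\<close>.\<close>
  have "xs \<longlonglongrightarrow> w" if "\<forall>x. graph_minimizing_solution K y D x0 x \<longrightarrow> x = w" for w
    using LIMSEQ_if_all_subseq_limits_eq[OF bd] main that by blast
  with ex main show ?thesis unfolding D_def z_def by blast
qed

end
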